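(* Let $k\geq 3$ and $n$ be positive integers and let $a_1<a_2<\cdots<a_k$ be positive integers satisfying $\frac{n}{2^{n}}=\sum_{i=1}^{k}\frac{a_{i}}{2^{a_{i}}}$. Then for every $i$ with $1\leq i\leq k-2$, $$2^{a_k-a_i}\leq \left(a_{i+2}\cdot a_{i+3}\cdots a_{k-1}\cdot a_k\right)\cdot a_k .$$
   Context: The equation $\frac{n}{2^{n}}=\sum_{i=1}^{k}\frac{a_{i}}{2^{a_{i}}}$ is considered in positive integers $n,k,a_1,\ldots,a_k$ with $k\geq 2$ and $a_1<\cdots<a_k$. *)

theory Defs
  imports Complex_Main
begin

end

theory Submission
  imports Defs
begin

text \<open>
  Nothing depends on the base being 2, so let \<open>b \<ge> 2\<close>, and write \<open>w n = n / b ^ n\<close> and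
  \<open>T i = (\<Sum>j>i. w (a j))\<close>. As \<open>w\<close> is nonincreasing on
  positive integers and the sum has several terms, \<open>w n = (\<Sum>j. w (a j))\<close> forces \<open>n < a 1\<close>.
  Multiplying the equation by \<open>b ^ a i\<close> therefore makes all terms integral except those of the
  tail, so \<open>b ^ a i * T i\<close> is an integer; being positive, it is at least 1. Applied to \<open>i + 1\<close>,
  this gives \<open>T i = w (a (i+1)) + T (i+1) \<le> (a (i+1) + 1) * T (i+1) \<le> a (i+2) * T (i+1)\<close>.
  Iterating up to \<open>T (k-1) = w (a k)\<close> yields \<open>1 / b ^ a i \<le> T i \<le> a (i+2) \<cdots> a k * w (a k)\<close>.
\<close>

definition pow_weight :: "nat \<Rightarrow> nat \<Rightarrow> real" where
  "pow_weight b n = real n / real b ^ n"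

definition weight_tail :: "nat \<Rightarrow> (nat \<Rightarrow> nat) \<Rightarrow> nat \<Rightarrow> nat \<Rightarrow> real" where
  "weight_tail b a k i = (\<Sum>j = Suc i..k. pow_weight b (a j))"

lemma pow_weight_nonneg: "0 \<le> pow_weight b n"
  by (simp add: pow_weight_def)

lemma pow_weight_pos: "0 < b \<Longrightarrow> 0 < n \<Longrightarrow> 0 < pow_weight b n"
  by (simp add: pow_weight_def)

lemma pow_weight_antimono:
  assumes base_ge_2: "2 \<le> b" and "0 < m" and "m \<le> n"
  shows "pow_weight b n \<le> pow_weight b m"
  using \<open>m \<le> n\<close>
proof (induction rule: dec_induct)
  case base
  show ?case by simp
next
  case (step n)
  have "Suc n \<le> 2 * n" using \<open>0 < m\<close> step.hyps by simp
  also have "\<dots> \<le> b * n" using base_ge_2 by simp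
  finally have "real (Suc n) \<le> real b * real n" by (simp flip: of_nat_mult)
  then have "pow_weight b (Suc n) \<le> real b * real n / real b ^ Suc n"
    unfolding pow_weight_def by (intro divide_right_mono) auto
  also have "\<dots> = pow_weight b n"
    using base_ge_2 by (simp add: pow_weight_def)
  also note step.IH
  finally show ?case .
qed

lemma power_mult_pow_weight_in_Ints:
  assumes "0 < b" "n \<le> m"
  shows "real b ^ m * pow_weight b n \<in> \<int>"
proof -
  have "real b ^ m * pow_weight b n = real b ^ (m - n) * real n"
    using assms by (simp add: pow_weight_def power_diff)
  also have "\<dots> = real (b ^ (m - n) * n)" by simp
  finally have "real b ^ m * pow_weight b n = real (b ^ (m - n) * n)" .
  then show ?thesis by (metis Ints_of_nat)
qed

lemma pow_weight_eq_sum_imp_less: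
  assumes base_ge_2: "2 \<le> b" and "finite I"
    and pos: "\<And>i. i \<in> I \<Longrightarrow> 0 < a i"
    and eq: "pow_weight b n = (\<Sum>i\<in>I. pow_weight b (a i))"
    and ij: "i \<in> I" "j \<in> I" "i \<noteq> j"
  shows "n < a i"
proof (rule ccontr)
  assume "\<not> n < a i"
  then have "pow_weight b n \<le> pow_weight b (a i)"
    using base_ge_2 pos[OF ij(1)] by (intro pow_weight_antimono) auto
  also have "\<dots> < pow_weight b (a i) + pow_weight b (a j)"
    using base_ge_2 pos[OF ij(2)] by (simp add: pow_weight_pos)
  also have "\<dots> = (\<Sum>l\<in>{i, j}. pow_weight b (a l))"
    using ij(3) by simp
  also have "\<dots> \<le> (\<Sum>l\<in>I. pow_weight b (a l))"
    using \<open>finite I\<close> ij by (intro sum_mono2) (auto simp: pow_weight_nonneg)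
  finally show False using eq by simp
qed

lemma power_mult_sum_above_in_Ints:
  assumes "0 < b" "finite I" "n \<le> m"
    and eq: "pow_weight b n = (\<Sum>i\<in>I. pow_weight b (a i))"
  shows "real b ^ m * (\<Sum>i | i \<in> I \<and> m < a i. pow_weight b (a i)) \<in> \<int>"
proof -
  let ?above = "{i \<in> I. m < a i}" and ?rest = "I - {i \<in> I. m < a i}"
  have "pow_weight b n
      = (\<Sum>i\<in>?rest. pow_weight b (a i)) + (\<Sum>i\<in>?above. pow_weight b (a i))"
    unfolding eq using \<open>finite I\<close> by (intro sum.subset_diff) auto
  then have "real b ^ m * (\<Sum>i\<in>?above. pow_weight b (a i))
      = real b ^ m * pow_weight b n - (\<Sum>i\<in>?rest. real b ^ m * pow_weight b (a i))"
    by (simp add: algebra_simps sum_distrib_left)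
  also have "\<dots> \<in> \<int>"
    using \<open>0 < b\<close> \<open>n \<le> m\<close> by (intro Ints_diff Ints_sum power_mult_pow_weight_in_Ints) auto
  finally show ?thesis .
qed

lemma one_le_power_mult_sum_above:
  assumes "0 < b" "finite I" "n \<le> m"
    and eq: "pow_weight b n = (\<Sum>i\<in>I. pow_weight b (a i))"
    and "j \<in> I" "m < a j"
  shows "1 \<le> real b ^ m * (\<Sum>i | i \<in> I \<and> m < a i. pow_weight b (a i))"
proof -
  have "0 < (\<Sum>i | i \<in> I \<and> m < a i. pow_weight b (a i))"
    using assms by (intro sum_pos) (auto intro: pow_weight_pos)
  then have "0 < real b ^ m * (\<Sum>i | i \<in> I \<and> m < a i. pow_weight b (a i))"
    using \<open>0 < b\<close> by simp
  with power_mult_sum_above_in_Ints[OF assms(1-4)] show ?thesis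
    using Ints_nonzero_abs_ge1 by fastforce
qed

lemma one_le_power_mult_weight_tail:
  assumes base_ge_2: "2 \<le> b"
    and pos: "\<And>i. i \<in> {1..k} \<Longrightarrow> 0 < a i"
    and mono: "strict_mono_on {1..k} a"
    and eq: "pow_weight b n = (\<Sum>i = 1..k. pow_weight b (a i))"
    and i: "1 \<le> i" "i < k"
  shows "1 \<le> real b ^ a i * weight_tail b a k i"
proof -
  have "n < a i"
    using i by (intro pow_weight_eq_sum_imp_less[OF base_ge_2 _ pos eq, where j = k]) auto
  moreover have "a i < a k"
    using strict_mono_onD[OF mono, of i k] i by simp
  ultimately have "1 \<le> real b ^ a i * (\<Sum>j | j \<in> {1..k} \<and> a i < a j. pow_weight b (a j))"
    using base_ge_2 i by (intro one_le_power_mult_sum_above[OF _ _ _ eq, where j = k]) auto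
  also have "{j \<in> {1..k}. a i < a j} = {Suc i..k}"
    using strict_mono_on_less[OF mono, of i] i by auto
  finally show ?thesis by (simp add: weight_tail_def)
qed

lemma weight_tail_rec:
  "i < k \<Longrightarrow> weight_tail b a k i = pow_weight b (a (Suc i)) + weight_tail b a k (Suc i)"
  by (simp add: weight_tail_def sum.atLeast_Suc_atMost)

lemma weight_tail_le_mult_weight_tail_Suc:
  assumes "0 < b" "Suc i < k" "a (Suc i) < a (i + 2)"
    and one_le: "1 \<le> real b ^ a (Suc i) * weight_tail b a k (Suc i)"
  shows "weight_tail b a k i \<le> real (a (i + 2)) * weight_tail b a k (Suc i)"
proof -
  have "pow_weight b (a (Suc i)) * 1
      \<le> pow_weight b (a (Suc i)) * (real b ^ a (Suc i) * weight_tail b a k (Suc i))"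
    using one_le pow_weight_nonneg by (rule mult_left_mono)
  then have "pow_weight b (a (Suc i)) \<le> real (a (Suc i)) * weight_tail b a k (Suc i)"
    using \<open>0 < b\<close> by (simp add: pow_weight_def)
  then have "weight_tail b a k i \<le> real (Suc (a (Suc i))) * weight_tail b a k (Suc i)"
    using \<open>Suc i < k\<close> by (simp add: weight_tail_rec algebra_simps)
  also have "\<dots> \<le> real (a (i + 2)) * weight_tail b a k (Suc i)"
    using \<open>a (Suc i) < a (i + 2)\<close> unfolding weight_tail_def
    by (intro mult_right_mono sum_nonneg pow_weight_nonneg) simp
  finally show ?thesis .
qed

lemma weight_tail_le_prod:
  assumes "0 < b" "i < k"
    and less: "\<And>j. i < j \<Longrightarrow> j < k \<Longrightarrow> a j < a (Suc j)"
    and one_le: "\<And>j. i < j \<Longrightarrow> j < k \<Longrightarrow> 1 \<le> real b ^ a j * weight_tail b a k j"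
  shows "weight_tail b a k i \<le> real (\<Prod>j = i + 2..k. a j) * pow_weight b (a k)"
  using \<open>i < k\<close> less one_le
proof (induction rule: strict_inc_induct)
  case (base i)
  then show ?case by (simp add: weight_tail_def)
next
  case (step i)
  have "weight_tail b a k i \<le> real (a (i + 2)) * weight_tail b a k (Suc i)"
    using \<open>0 < b\<close> step.hyps step.prems
    by (intro weight_tail_le_mult_weight_tail_Suc) auto
  also have "\<dots> \<le> real (a (i + 2)) * (real (\<Prod>j = Suc i + 2..k. a j) * pow_weight b (a k))"
    using step.IH step.prems by (intro mult_left_mono) auto
  also have "\<dots> = real (\<Prod>j = i + 2..k. a j) * pow_weight b (a k)"
    using step.hyps prod.atLeast_Suc_atMost[of "i + 2" k a] by simp
  finally show ?case .
qed

theorem power_diff_le_prod_mult: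
  fixes b n k i :: nat and a :: "nat \<Rightarrow> nat"
  assumes base_ge_2: "2 \<le> b"
    and pos: "\<And>i. i \<in> {1..k} \<Longrightarrow> 0 < a i"
    and mono: "strict_mono_on {1..k} a"
    and eq: "pow_weight b n = (\<Sum>i = 1..k. pow_weight b (a i))"
    and i: "1 \<le> i" "i < k"
  shows "b ^ (a k - a i) \<le> (\<Prod>j = i + 2..k. a j) * a k"
proof -
  have one_le: "1 \<le> real b ^ a j * weight_tail b a k j" if "i \<le> j" "j < k" for j
    using i that by (intro one_le_power_mult_weight_tail[OF base_ge_2 pos mono eq]) auto
  have "a i \<le> a k"
    using strict_mono_onD[OF mono, of i k] i by simp
  then have "real b ^ (a k - a i) = real b ^ a k / real b ^ a i"
    using base_ge_2 by (simp add: power_diff)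
  also have "\<dots> \<le> real b ^ a k * weight_tail b a k i"
    using one_le[of i] i(2) base_ge_2 by (simp add: field_simps)
  also have "\<dots> \<le> real b ^ a k * (real (\<Prod>j = i + 2..k. a j) * pow_weight b (a k))"
    using base_ge_2 i strict_mono_onD[OF mono] one_le
    by (intro mult_left_mono weight_tail_le_prod) auto
  also have "\<dots> = real ((\<Prod>j = i + 2..k. a j) * a k)"
    using base_ge_2 by (simp add: pow_weight_def)
  finally show ?thesis
    by (simp only: of_nat_le_iff flip: of_nat_power)
qed

theorem theorem2p3:
  fixes n k :: nat and a :: "nat \<Rightarrow> nat"
  assumes "k \<ge> 3" and "n > 0"
    and "\<And>i. i \<in> {1..k} \<Longrightarrow> a i > 0"
    and "strict_mono_on {1..k} a"
    and "real n / 2 ^ n = (\<Sum>i = 1..k. real (a i) / 2 ^ a i)"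
  shows "\<forall>i \<in> {1..k - 2}. 2 ^ (a k - a i) \<le> (\<Prod>j = i + 2..k. a j) * a k"
proof
  fix i assume "i \<in> {1..k - 2}"
  moreover have "pow_weight 2 n = (\<Sum>i = 1..k. pow_weight 2 (a i))"
    using assms(5) by (simp add: pow_weight_def)
  ultimately show "2 ^ (a k - a i) \<le> (\<Prod>j = i + 2..k. a j) * a k"
    using assms(1) by (intro power_diff_le_prod_mult[OF _ assms(3,4)]) auto
qed

end
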